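(* Let $\mathcal{Q}_\mathrm{con}^{(L)}=\mathcal{Q}_L \circ \cdots \circ \mathcal{Q}_1$ be an $L$-level concatenated code with parameters $[\![N,K,D]\!]$. Suppose that every $\mathcal{Q}_i$ ($i \in [L]$) is an $[\![n_i,k_i,d_i]\!]$ self-dual CSS code with $k_i\ge 1$, constructed from a binary linear code $\mathcal{D}_i$ with $\mathcal{D}_i^\perp\subsetneq\mathcal{D}_i$, such that, writing $\mathcal{D}_i=\langle \mathcal{D}_i^\perp,\mathbf{h}_1,\dots,\mathbf{h}_{k_i}\rangle$, there is $j\in[k_i]$ with $\mathbf{h}_j\cdot\mathbf{h}_j=1$ (equivalently, $\mathcal{Q}_i$ has a compatible symplectic basis), and that the logical Pauli operators of each $\mathcal{Q}_i$ are defined by a compatible symplectic basis. Then, for any $l \in \{0,\dots,L\}$ and for any $B_1\subseteq[k_1],\dots,B_{l}\subseteq[k_l],A_{l+1}\subseteq[n_{l+1}],\dots,A_L\subseteq[n_L]$, every Pauli-type transversal gate at the $l$-th level $U_P^{(l)}\left(B_1,\dots,B_l,A_{l+1},\dots,A_L\right)$ is transversal at levels $0,\dots,l$.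
   Context: $[k]=\{1,\dots,k\}$; $\mathbf{a}\cdot\mathbf{b}=\sum_i a_ib_i \pmod 2$ on $\mathbb{Z}_2^n$. Self-dual CSS code: for a binary linear code $\mathcal{D}\subseteq\mathbb{Z}_2^n$ with $\mathcal{D}^\perp\subseteq\mathcal{D}$ and a full-row-rank parity check matrix with rows $\mathbf{g}_1,\dots,\mathbf{g}_r$, it is the stabilizer code whose stabilizer group $S$ is generated by the $X$-type and $Z$-type Pauli operators supported on the supports of the $\mathbf{g}_i$; it encodes $k=n-2r$ logical qubits. A symplectic basis is a set of $k$ pairs $\{(\bar X_j,\bar Z_j)\}_{j\in[k]}$ of Pauli operators commuting with $S$ which together with $S$ and $iI^{\otimes n}$ generate the centralizer $C(S)$ of $S$ in the Pauli group, with $\bar X_j,\bar Z_j$ anticommuting for each $j$ and all other pairs among the $\bar X$'s and $\bar Z$'s commuting. It defines the logical Pauli operators and hence logical gates. Equalities between gates mean equality of the action on the encoded space, up to global phase. With $H_i$ (Hadamard) and $S_i$ (phase gate $\mathrm{diag}(1,i)$) on physical qubits and $\bar H_j,\bar S_j$ on logical qubits, a symplectic basis is compatible (with multilevel transversal Clifford operations) if (i) $\bigotimes_{j=1}^k\bar H_j=\bigotimes_{i=1}^n H_i$; and (ii) for any $(a_1,\dots,a_k)\in\{-1,1\}^k$ there is $(b_1,\dots,b_n)\in\{-1,1\}^n$ with $\bigotimes_{j=1}^k\bar S_j^{a_j}=\bigotimes_{i=1}^nS_i^{b_i}$. Concatenated code: given $[\![n_i,k_i,d_i]\!]$ stabilizer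 codes $\mathcal{Q}_i$, $i\in[L]$, the $L$-level concatenated code $\mathcal{Q}_\mathrm{con}^{(L)}=\mathcal{Q}_L\circ\cdots\circ\mathcal{Q}_1$ has $N=\prod_i n_i$ physical qubits and $K=\prod_i k_i$ logical qubits; $D$ is its distance. Logical qubits at the $l$-th level ($l\in\{0,\dots,L\}$) are indexed by $(j_1,\dots,j_l,i_{l+1},\dots,i_L)\in[k_1]\times\cdots\times[k_l]\times[n_{l+1}]\times\cdots\times[n_L]$, so there are $N^{(l)}=\prod_{i\le l}k_i\prod_{j>l}n_j$ of them; level $0$ qubits are the physical qubits, and level $L$ qubits are the logical qubits of $\mathcal{Q}_\mathrm{con}^{(L)}$. For each $l\in[L]$ and each fixed $j_1,\dots,j_{l-1},i_{l+1},\dots,i_L$, the $n_l$ level-$(l-1)$ qubits $(j_1,\dots,j_{l-1},i_l,i_{l+1},\dots,i_L)$, $i_l\in[n_l]$, form a block of $\mathcal{Q}_l$, whose $k_l$ logical qubits are the level-$l$ qubits $(j_1,\dots,j_{l-1},j_l,i_{l+1},\dots,i_L)$, $j_l\in[k_l]$. A gate $U^{(l)}$ on one block of $\mathcal{Q}_\mathrm{con}^{(L)}$, acting on the $N^{(l)}$ level-$l$ qubits, is transversal at the $m$-th level if $U^{(l)}=\bigotimes_{i=1}^{N^{(m)}}G_i^{(m)}$ where $G_i^{(m)}$ is a single-qubit gate on the $i$-th level-$m$ qubit. A Pauli-type transversal gate at the $l$-th level $U_P^{(l)}(B_1,\dots,B_l,A_{l+1},\dots,A_L)$ is a gate on one block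 applying one of the level-$l$ Pauli gates $X^{(l)},Y^{(l)},Z^{(l)}$ (chosen independently for each qubit) to each level-$l$ qubit with index in $B_1\times\cdots\times B_l\times A_{l+1}\times\cdots\times A_L$, and the identity to all other level-$l$ qubits. *)

theory Defs
  imports
    Complex_Main
    "HOL-Library.FuncSet"
    "HOL-Library.Z2"
    "HOL-Algebra.Generated_Groups"
    "Jordan_Normal_Form.Matrix_Kernel"
    "Jordan_Normal_Form.DL_Rank"
begin

section \<open>States and operators on a finite set of qubits\<close>

text \<open>
  Qubits are elements of a finite set \<open>Q\<close>. A computational basis state is labelled by an
  (extensional) bit assignment to \<open>Q\<close>; a state assigns amplitudes to labels and vanishes off
  the labels of \<open>Q\<close>. An operator from qubits \<open>Q\<close> to qubits \<open>P\<close> is given by its matrix entries,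
  output label first. The sets \<open>[k]\<close> and \<open>[n]\<close> indexing the qubits of a block are rendered
  as \<open>{..<k}\<close> and \<open>{..<n}\<close>, matching the indexing of \<open>vec\<close> and \<open>mat\<close>; codes and levels
  are numbered from 1.
\<close>

type_synonym 'q label = "'q \<Rightarrow> bool"
type_synonym 'q state = "'q label \<Rightarrow> complex"
type_synonym ('p, 'q) oper = "'p label \<Rightarrow> 'q label \<Rightarrow> complex"
type_synonym gate1 = "bool \<Rightarrow> bool \<Rightarrow> complex"

definition labels :: "'q set \<Rightarrow> 'q label set" where
  "labels Q = Q \<rightarrow>\<^sub>E (UNIV :: bool set)"

definition state_space :: "'q set \<Rightarrow> 'q state set" where
  "state_space Q = {\<psi>. \<forall>x. x \<notin> labels Q \<longrightarrow> \<psi> x = 0}"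

definition opers :: "'p set \<Rightarrow> 'q set \<Rightarrow> ('p, 'q) oper set" where
  "opers P Q = {A. \<forall>y x. y \<notin> labels P \<or> x \<notin> labels Q \<longrightarrow> A y x = 0}"

definition oapply :: "'q set \<Rightarrow> ('p, 'q) oper \<Rightarrow> 'q state \<Rightarrow> 'p state" where
  "oapply Q A \<psi> = (\<lambda>y. \<Sum>x\<in>labels Q. A y x * \<psi> x)"

definition omult :: "'q set \<Rightarrow> ('p, 'q) oper \<Rightarrow> ('q, 'r) oper \<Rightarrow> ('p, 'r) oper" where
  "omult Q A B = (\<lambda>y x. \<Sum>z\<in>labels Q. A y z * B z x)"

definition oadjoint :: "('p, 'q) oper \<Rightarrow> ('q, 'p) oper" where
  "oadjoint A = (\<lambda>x y. cnj (A y x))"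

definition tensor :: "'q set \<Rightarrow> ('q \<Rightarrow> gate1) \<Rightarrow> ('q, 'q) oper" where
  "tensor Q G = (\<lambda>y x. if y \<in> labels Q \<and> x \<in> labels Q then \<Prod>q\<in>Q. G q (y q) (x q) else 0)"

definition unitary1 :: "gate1 \<Rightarrow> bool" where
  "unitary1 G \<longleftrightarrow> (\<forall>a b. (\<Sum>c\<in>UNIV. cnj (G c a) * G c b) = of_bool (a = b))"


section \<open>Pauli operators\<close>

datatype pauli = PI | PX | PY | PZ

fun pauli_gate :: "pauli \<Rightarrow> gate1" where
  "pauli_gate PI a b = of_bool (a = b)"
| "pauli_gate PX a b = of_bool (a \<noteq> b)"
| "pauli_gate PY a b = (if a = b then 0 else if a then \<i> else - \<i>)"
| "pauli_gate PZ a b = (if a = b then (if a then -1 else 1) else 0)"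

definition hadamard_gate :: gate1 where
  "hadamard_gate a b = (if a \<and> b then -1 else 1) / complex_of_real (sqrt 2)"

text \<open>The power \<open>S\<^sup>e\<close> of the phase gate \<open>S = diag(1, \<i>)\<close>.\<close>
definition phase_gate_pow :: "int \<Rightarrow> gate1" where
  "phase_gate_pow e a b = (if a = b then (if a then \<i> powi e else 1) else 0)"

definition pauli_oper :: "'q set \<Rightarrow> nat \<Rightarrow> ('q \<Rightarrow> pauli) \<Rightarrow> ('q, 'q) oper" where
  "pauli_oper Q c p = (\<lambda>y x. \<i> ^ c * tensor Q (\<lambda>q. pauli_gate (p q)) y x)"

definition identity_oper :: "'q set \<Rightarrow> ('q, 'q) oper" where
  "identity_oper Q = pauli_oper Q 0 (\<lambda>_. PI)"

definition pauli_at :: "'q set \<Rightarrow> pauli \<Rightarrow> 'q \<Rightarrow> ('q, 'q) oper" where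
  "pauli_at Q s q = pauli_oper Q 0 ((\<lambda>_. PI)(q := s))"

definition pauli_group :: "'q set \<Rightarrow> ('q, 'q) oper monoid" where
  "pauli_group Q =
     \<lparr>carrier = {pauli_oper Q c p | c p. True}, mult = omult Q, one = identity_oper Q\<rparr>"

definition pauli_centralizer :: "'q set \<Rightarrow> ('q, 'q) oper set \<Rightarrow> ('q, 'q) oper set" where
  "pauli_centralizer Q S =
     {P \<in> carrier (pauli_group Q). \<forall>s\<in>S. omult Q P s = omult Q s P}"


section \<open>Stabilizer codes and their distance\<close>

definition code_space :: "'q set \<Rightarrow> ('q, 'q) oper set \<Rightarrow> 'q state set" where
  "code_space Q S = {\<psi> \<in> state_space Q. \<forall>s\<in>S. oapply Q s \<psi> = \<psi>}"

definition stabilizer_of :: "'q set \<Rightarrow> 'q state set \<Rightarrow> ('q, 'q) oper set" where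
  "stabilizer_of Q C = {P \<in> carrier (pauli_group Q). \<forall>\<psi>\<in>C. oapply Q P \<psi> = \<psi>}"

text \<open>
  Minimum weight of a Pauli operator in \<open>C(S)\<close> that is not an element of \<open>S\<close> up to a phase.
\<close>
definition code_distance :: "'q set \<Rightarrow> ('q, 'q) oper set \<Rightarrow> nat" where
  "code_distance Q S =
     (LEAST w. \<exists>c p. pauli_oper Q c p \<in> pauli_centralizer Q S
                      - generate (pauli_group Q) (insert (pauli_oper Q 1 (\<lambda>_. PI)) S)
                    \<and> w = card {q \<in> Q. p q \<noteq> PI})"


section \<open>Self-dual CSS codes\<close>

abbreviation dual_code :: "nat \<Rightarrow> bit vec set \<Rightarrow> bit vec set" where
  "dual_code n D \<equiv> vec_module.orthogonal_complement n D"

abbreviation code_span :: "nat \<Rightarrow> bit vec set \<Rightarrow> bit vec set" where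
  "code_span n A \<equiv> LinearCombinations.module.span class_ring (module_vec TYPE(bit) n) A"

definition pauli_on_support :: "nat \<Rightarrow> pauli \<Rightarrow> bit vec \<Rightarrow> (nat, nat) oper" where
  "pauli_on_support n s g = pauli_oper {..<n} 0 (\<lambda>q. if g $ q = 1 then s else PI)"

definition css_stabilizer :: "nat \<Rightarrow> bit mat \<Rightarrow> (nat, nat) oper set" where
  "css_stabilizer n G = generate (pauli_group {..<n})
     (pauli_on_support n PX ` set (rows G) \<union> pauli_on_support n PZ ` set (rows G))"

text \<open>
  The code constructed from \<open>D\<close> with full-row-rank parity check matrix \<open>G\<close> is an
  \<open>[[n, k, d]]\<close> self-dual CSS code.
\<close>
definition self_dual_css_code ::
    "bit vec set \<Rightarrow> bit mat \<Rightarrow> nat \<Rightarrow> nat \<Rightarrow> nat \<Rightarrow> bool" where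
  "self_dual_css_code D G n k d \<longleftrightarrow>
     subspace class_ring D (module_vec TYPE(bit) n) \<and>
     dual_code n D \<subseteq> D \<and>
     dim_col G = n \<and> mat_kernel G = D \<and> vec_space.rank (dim_row G) G = dim_row G \<and>
     n = k + 2 * dim_row G \<and>
     d = code_distance {..<n} (css_stabilizer n G)"


section \<open>Symplectic bases, logical gates and compatibility\<close>

definition symplectic_basis ::
    "nat \<Rightarrow> nat \<Rightarrow> (nat, nat) oper set \<Rightarrow>
     (nat \<Rightarrow> (nat, nat) oper) \<Rightarrow> (nat \<Rightarrow> (nat, nat) oper) \<Rightarrow> bool" where
  "symplectic_basis n k S X Z \<longleftrightarrow>
     (\<forall>j<k. X j \<in> pauli_centralizer {..<n} S \<and> Z j \<in> pauli_centralizer {..<n} S) \<and>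
     generate (pauli_group {..<n})
       (X ` {..<k} \<union> Z ` {..<k} \<union> S \<union> {pauli_oper {..<n} 1 (\<lambda>_. PI)})
       = pauli_centralizer {..<n} S \<and>
     (\<forall>j<k. omult {..<n} (X j) (Z j) = (\<lambda>y x. - omult {..<n} (Z j) (X j) y x)) \<and>
     (\<forall>i<k. \<forall>j<k. omult {..<n} (X i) (X j) = omult {..<n} (X j) (X i)) \<and>
     (\<forall>i<k. \<forall>j<k. omult {..<n} (Z i) (Z j) = omult {..<n} (Z j) (Z i)) \<and>
     (\<forall>i<k. \<forall>j<k. i \<noteq> j \<longrightarrow> omult {..<n} (X i) (Z j) = omult {..<n} (Z j) (X i))"

text \<open>
  A symplectic basis defines logical qubits: there is an isometry \<open>V\<close> from \<open>k\<close> qubits onto the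
  code space, unique up to a global phase, that turns the Pauli gates of the \<open>j\<close>-th qubit into
  \<open>X j\<close> and \<open>Z j\<close>. (The existence of \<open>V\<close> fixes the signs: each \<open>X j\<close> and \<open>Z j\<close> squares
  to the identity.) A logical gate \<open>U\<close> is the operator on the code space that sends
  \<open>V \<psi>\<close> to \<open>V (U \<psi>)\<close>.
\<close>
definition encoder ::
    "nat \<Rightarrow> nat \<Rightarrow> (nat, nat) oper set \<Rightarrow>
     (nat \<Rightarrow> (nat, nat) oper) \<Rightarrow> (nat \<Rightarrow> (nat, nat) oper) \<Rightarrow> (nat, nat) oper \<Rightarrow> bool" where
  "encoder n k S X Z V \<longleftrightarrow>
     V \<in> opers {..<n} {..<k} \<and>
     omult {..<n} (oadjoint V) V = identity_oper {..<k} \<and>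
     oapply {..<k} V ` state_space {..<k} = code_space {..<n} S \<and>
     (\<forall>j<k. omult {..<k} V (pauli_at {..<k} PX j) = omult {..<n} (X j) V \<and>
            omult {..<k} V (pauli_at {..<k} PZ j) = omult {..<n} (Z j) V)"

text \<open>
  With qubits \<open>Q\<close> encoded into qubits \<open>P\<close> by the map \<open>E\<close>: the gate \<open>B\<close> on \<open>Q\<close> and the gate
  \<open>A\<close> on \<open>P\<close> act equally on the encoded space, up to a global phase.
\<close>
definition same_action ::
    "('q state \<Rightarrow> 'p state) \<Rightarrow> 'q set \<Rightarrow> ('q, 'q) oper \<Rightarrow> 'p set \<Rightarrow> ('p, 'p) oper \<Rightarrow> bool" where
  "same_action E Q B P A \<longleftrightarrow>
     (\<exists>c. cmod c = 1 \<and>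
       (\<forall>\<psi>\<in>state_space Q. E (oapply Q B \<psi>) = (\<lambda>y. c * oapply P A (E \<psi>) y)))"

text \<open>Compatibility of the symplectic basis whose logical qubits are given by the encoder \<open>V\<close>.\<close>
definition compatible :: "nat \<Rightarrow> nat \<Rightarrow> (nat, nat) oper \<Rightarrow> bool" where
  "compatible n k V \<longleftrightarrow>
     same_action (oapply {..<k} V)
       {..<k} (tensor {..<k} (\<lambda>_. hadamard_gate))
       {..<n} (tensor {..<n} (\<lambda>_. hadamard_gate)) \<and>
     (\<forall>a \<in> {..<k} \<rightarrow> {-1, 1}. \<exists>b \<in> {..<n} \<rightarrow> {-1, 1}.
       same_action (oapply {..<k} V)
         {..<k} (tensor {..<k} (\<lambda>j. phase_gate_pow (a j)))
         {..<n} (tensor {..<n} (\<lambda>i. phase_gate_pow (b i))))"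

definition compatible_symplectic_basis ::
    "nat \<Rightarrow> nat \<Rightarrow> (nat, nat) oper set \<Rightarrow>
     (nat \<Rightarrow> (nat, nat) oper) \<Rightarrow> (nat \<Rightarrow> (nat, nat) oper) \<Rightarrow> (nat, nat) oper \<Rightarrow> bool" where
  "compatible_symplectic_basis n k S X Z V \<longleftrightarrow>
     symplectic_basis n k S X Z \<and> encoder n k S X Z V \<and> compatible n k V"


section \<open>Concatenated codes\<close>

text \<open>
  A level-\<open>l\<close> qubit \<open>(j\<^sub>1, \<dots>, j\<^sub>l, i\<^sub>l\<^sub>+\<^sub>1, \<dots>, i\<^sub>L)\<close> is an extensional function on \<open>{1..L}\<close>.
\<close>

type_synonym qubit = "nat \<Rightarrow> nat"

definition level_qubits :: "(nat \<Rightarrow> nat) \<Rightarrow> (nat \<Rightarrow> nat) \<Rightarrow> nat \<Rightarrow> nat \<Rightarrow> qubit set" where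
  "level_qubits n k L l = (\<Pi>\<^sub>E p\<in>{1..L}. {..<(if p \<le> l then k p else n p)})"

text \<open>
  A block of the \<open>l\<close>-th code is given by all coordinates but the \<open>l\<close>-th. The block \<open>b\<close> consists
  of the level-\<open>(l - 1)\<close> qubits \<open>b(l := i)\<close>, \<open>i < n l\<close>; its logical qubits are the level-\<open>l\<close>
  qubits \<open>b(l := j)\<close>, \<open>j < k l\<close>.
\<close>
definition blocks :: "(nat \<Rightarrow> nat) \<Rightarrow> (nat \<Rightarrow> nat) \<Rightarrow> nat \<Rightarrow> nat \<Rightarrow> (nat \<Rightarrow> nat) set" where
  "blocks n k L l = (\<Pi>\<^sub>E p\<in>{1..L} - {l}. {..<(if p < l then k p else n p)})"

text \<open>The tensor product, over all blocks of the \<open>l\<close>-th code, of its encoder \<open>V l\<close>.\<close>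
definition level_encoder ::
    "(nat \<Rightarrow> nat) \<Rightarrow> (nat \<Rightarrow> nat) \<Rightarrow> nat \<Rightarrow> (nat \<Rightarrow> (nat, nat) oper) \<Rightarrow> nat \<Rightarrow> (qubit, qubit) oper" where
  "level_encoder n k L V l = (\<lambda>y x.
     if y \<in> labels (level_qubits n k L (l - 1)) \<and> x \<in> labels (level_qubits n k L l)
     then \<Prod>b\<in>blocks n k L l.
            V l (\<lambda>i\<in>{..<n l}. y (b(l := i))) (\<lambda>j\<in>{..<k l}. x (b(l := j)))
     else 0)"

text \<open>
  \<open>encode n k L V m l\<close> maps states of the level-\<open>l\<close> qubits to states of the level-\<open>m\<close> qubits;
  it is meaningful for \<open>m \<le> l \<le> L\<close>.
\<close>
primrec encode ::
    "(nat \<Rightarrow> nat) \<Rightarrow> (nat \<Rightarrow> nat) \<Rightarrow> nat \<Rightarrow> (nat \<Rightarrow> (nat, nat) oper) \<Rightarrow> nat \<Rightarrow> nat \<Rightarrow>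
     qubit state \<Rightarrow> qubit state" where
  "encode n k L V m 0 \<psi> = \<psi>"
| "encode n k L V m (Suc l) \<psi> =
     (if m \<le> l
      then encode n k L V m l (oapply (level_qubits n k L (Suc l)) (level_encoder n k L V (Suc l)) \<psi>)
      else \<psi>)"

definition concatenated_code ::
    "(nat \<Rightarrow> nat) \<Rightarrow> (nat \<Rightarrow> nat) \<Rightarrow> nat \<Rightarrow> (nat \<Rightarrow> (nat, nat) oper) \<Rightarrow> qubit state set" where
  "concatenated_code n k L V = encode n k L V 0 L ` state_space (level_qubits n k L L)"

text \<open>The concatenated code, on the level-0 qubits, has parameters \<open>[[N, K, d]]\<close>.\<close>
definition concatenated_code_params ::
    "(nat \<Rightarrow> nat) \<Rightarrow> (nat \<Rightarrow> nat) \<Rightarrow> nat \<Rightarrow> (nat \<Rightarrow> (nat, nat) oper) \<Rightarrow>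
     nat \<Rightarrow> nat \<Rightarrow> nat \<Rightarrow> bool" where
  "concatenated_code_params n k L V N K d \<longleftrightarrow>
     N = (\<Prod>i\<in>{1..L}. n i) \<and> K = (\<Prod>i\<in>{1..L}. k i) \<and>
     d = code_distance (level_qubits n k L 0)
           (stabilizer_of (level_qubits n k L 0) (concatenated_code n k L V))"


section \<open>Transversal gates\<close>

text \<open>
  The gate \<open>U\<close> on the level-\<open>l\<close> qubits is transversal at level \<open>m\<close>: as an operator on the states
  of the level-\<open>m\<close> qubits that encode level-\<open>l\<close> states, it is a tensor product of single-qubit gates.
\<close>
definition transversal_at ::
    "(nat \<Rightarrow> nat) \<Rightarrow> (nat \<Rightarrow> nat) \<Rightarrow> nat \<Rightarrow> (nat \<Rightarrow> (nat, nat) oper) \<Rightarrow>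
     nat \<Rightarrow> (qubit, qubit) oper \<Rightarrow> nat \<Rightarrow> bool" where
  "transversal_at n k L V l U m \<longleftrightarrow>
     (\<exists>G. (\<forall>q\<in>level_qubits n k L m. unitary1 (G q)) \<and>
          same_action (encode n k L V m l)
            (level_qubits n k L l) U
            (level_qubits n k L m) (tensor (level_qubits n k L m) G))"

definition pauli_type_gate ::
    "(nat \<Rightarrow> nat) \<Rightarrow> (nat \<Rightarrow> nat) \<Rightarrow> nat \<Rightarrow> nat \<Rightarrow>
     (nat \<Rightarrow> nat set) \<Rightarrow> (nat \<Rightarrow> nat set) \<Rightarrow> (qubit, qubit) oper \<Rightarrow> bool" where
  "pauli_type_gate n k L l B A U \<longleftrightarrow>
     (\<exists>p. (\<forall>q \<in> level_qubits n k L l.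
             if q \<in> (\<Pi>\<^sub>E i\<in>{1..L}. if i \<le> l then B i else A i)
             then p q \<in> {PX, PY, PZ} else p q = PI) \<and>
          U = tensor (level_qubits n k L l) (\<lambda>q. pauli_gate (p q)))"

end

theory Submission
  imports Defs
begin

text \<open>
  The logical Pauli operators of each code are physical Pauli operators, so its encoder carries every
  tensor product of Pauli gates, up to a phase, to a tensor product of Pauli gates. The encoder of
  one level is a tensor product of such encoders over the blocks, so it has the same property, and
  hence so has every composition of level encoders.
\<close>

abbreviation pauli_string :: "'q set \<Rightarrow> ('q \<Rightarrow> pauli) \<Rightarrow> ('q, 'q) oper" where
  "pauli_string Q p \<equiv> tensor Q (\<lambda>q. pauli_gate (p q))"

text \<open>The intertwining relation \<open>V P = c P' V\<close>. As an identity of operators it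
  can be chained by associativity. The phase is any complex number of modulus one, which is what
  \<open>same_action\<close> tolerates, so strings carry no phase of their own.\<close>

definition maps_pauli :: "'p set \<Rightarrow> 'q set \<Rightarrow> ('p, 'q) oper \<Rightarrow> ('q \<Rightarrow> pauli) \<Rightarrow> bool" where
  "maps_pauli P Q V p \<longleftrightarrow> (\<exists>c p'. cmod c = 1 \<and>
     omult Q V (pauli_string Q p) = (\<lambda>y x. c * omult P (pauli_string P p') V y x))"

section \<open>Operators\<close>

lemma finite_labels: "finite Q \<Longrightarrow> finite (labels Q)"
  by (auto simp: labels_def intro!: finite_PiE)

lemma omult_assoc: "omult Q A (omult R B C) = omult R (omult Q A B) C"
proof (intro ext)
  fix y x
  have "omult Q A (omult R B C) y x = (\<Sum>z\<in>labels Q. \<Sum>w\<in>labels R. A y z * B z w * C w x)"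
    by (simp add: omult_def sum_distrib_left mult.assoc)
  also have "\<dots> = omult R (omult Q A B) C y x"
    by (subst sum.swap) (simp add: omult_def sum_distrib_right)
  finally show "omult Q A (omult R B C) y x = omult R (omult Q A B) C y x" .
qed

lemma omult_scale_left: "omult Q (\<lambda>y x. c * A y x) B = (\<lambda>y x. c * omult Q A B y x)"
  by (simp add: omult_def sum_distrib_left mult.assoc)

lemma omult_scale_right: "omult Q A (\<lambda>y x. c * B y x) = (\<lambda>y x. c * omult Q A B y x)"
  by (simp add: omult_def sum_distrib_left mult.left_commute)

lemma oapply_omult: "oapply Q A (oapply R B \<psi>) = oapply R (omult Q A B) \<psi>"
proof (intro ext)
  fix y
  have "oapply Q A (oapply R B \<psi>) y = (\<Sum>z\<in>labels Q. \<Sum>w\<in>labels R. A y z * B z w * \<psi> w)"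
    by (simp add: oapply_def sum_distrib_left mult.assoc)
  also have "\<dots> = oapply R (omult Q A B) \<psi> y"
    by (subst sum.swap) (simp add: omult_def oapply_def sum_distrib_right)
  finally show "oapply Q A (oapply R B \<psi>) y = oapply R (omult Q A B) \<psi> y" .
qed

lemma oapply_scale_left: "oapply Q (\<lambda>y x. c * A y x) \<psi> = (\<lambda>y. c * oapply Q A \<psi> y)"
  by (simp add: oapply_def sum_distrib_left mult.assoc)

lemma oapply_scale_right: "oapply Q A (\<lambda>y. c * \<psi> y) = (\<lambda>y. c * oapply Q A \<psi> y)"
  by (simp add: oapply_def sum_distrib_left mult.left_commute)

lemma tensor_cong: "(\<And>q a b. q \<in> Q \<Longrightarrow> F q a b = G q a b) \<Longrightarrow> tensor Q F = tensor Q G"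
  by (auto simp: tensor_def intro!: ext prod.cong)

lemma tensor_scale:
  "tensor Q (\<lambda>q a b. c q * F q a b) = (\<lambda>y x. (\<Prod>q\<in>Q. c q) * tensor Q F y x)"
  by (auto simp: tensor_def prod.distrib fun_eq_iff)

text \<open>Distributivity: a label is an independent choice of one bit per qubit, so expanding the
  product of sums gives one term per label. This is why tensor products multiply qubit by
  qubit.\<close>

lemma sum_labels_prod:
  fixes f :: "'q \<Rightarrow> bool \<Rightarrow> 'a :: comm_semiring_1"
  assumes "finite Q"
  shows "(\<Sum>z\<in>labels Q. \<Prod>q\<in>Q. f q (z q)) = (\<Prod>q\<in>Q. \<Sum>c\<in>UNIV. f q c)"
  unfolding labels_def using assms by (simp add: prod_sum_PiE)

lemma omult_tensor:
  assumes "finite Q"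
  shows "omult Q (tensor Q F) (tensor Q G) = tensor Q (\<lambda>q a b. \<Sum>c\<in>UNIV. F q a c * G q c b)"
proof (intro ext)
  fix y x
  show "omult Q (tensor Q F) (tensor Q G) y x =
      tensor Q (\<lambda>q a b. \<Sum>c\<in>UNIV. F q a c * G q c b) y x"
    using sum_labels_prod[OF assms, of "\<lambda>q c. F q (y q) c * G q c (x q)"]
    by (auto simp: omult_def tensor_def prod.distrib)
qed

section \<open>Tensor products of Pauli gates\<close>

lemma unitary1_pauli_gate: "unitary1 (pauli_gate s)"
  by (cases s) (auto simp: unitary1_def UNIV_bool)

lemma pauli_gate_mult:
  "\<exists>c r. cmod c = 1 \<and> (\<forall>a b. (\<Sum>z\<in>UNIV. pauli_gate s a z * pauli_gate t z b) = c * pauli_gate r a b)"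
proof -
  \<comment> \<open>Naming the finitely many possible phases and results turns each of the sixteen
    products into an evaluation.\<close>
  have "\<exists>c\<in>{1, \<i>, - \<i>}. \<exists>r\<in>{PI, PX, PY, PZ}.
      \<forall>a b. (\<Sum>z\<in>UNIV. pauli_gate s a z * pauli_gate t z b) = c * pauli_gate r a b"
    by (cases s; cases t; simp add: UNIV_bool all_bool_eq)
  then obtain c r where "c \<in> {1, \<i>, - \<i>}"
    "\<forall>a b. (\<Sum>z\<in>UNIV. pauli_gate s a z * pauli_gate t z b) = c * pauli_gate r a b"
    by blast
  moreover from this(1) have "cmod c = 1" by auto
  ultimately show ?thesis by blast
qed

text \<open>The phases picked up at the single qubits collect into their product, which again has
  modulus one.\<close>

lemma omult_pauli_string:
  assumes "finite Q"
  shows "\<exists>c r. cmod c = 1 \<and>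
    omult Q (pauli_string Q p) (pauli_string Q p') = (\<lambda>y x. c * pauli_string Q r y x)"
proof -
  obtain c r where c: "\<And>q. cmod (c q) = 1"
    and r: "\<And>q a b. (\<Sum>z\<in>UNIV. pauli_gate (p q) a z * pauli_gate (p' q) z b)
      = c q * pauli_gate (r q) a b"
    using pauli_gate_mult[of "p q" "p' q" for q] by metis
  have "omult Q (pauli_string Q p) (pauli_string Q p')
      = (\<lambda>y x. (\<Prod>q\<in>Q. c q) * pauli_string Q r y x)"
    by (simp add: omult_tensor[OF assms] r tensor_scale)
  moreover have "cmod (\<Prod>q\<in>Q. c q) = 1"
    by (simp add: c flip: prod_norm)
  ultimately show ?thesis by blast
qed

text \<open>Labels are extensional, so two different ones differ at some qubit of \<open>Q\<close>,
  and there the identity gate contributes a factor 0.\<close>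

lemma pauli_string_PI:
  assumes "finite Q"
  shows "pauli_string Q (\<lambda>_. PI) = (\<lambda>y x. of_bool (y = x \<and> x \<in> labels Q))"
proof (intro ext)
  fix y x
  show "pauli_string Q (\<lambda>_. PI) y x = of_bool (y = x \<and> x \<in> labels Q)"
  proof (cases "y \<in> labels Q \<and> x \<in> labels Q \<and> y \<noteq> x")
    case True
    then obtain q where "q \<in> Q" "y q \<noteq> x q"
      using PiE_ext[of y Q "\<lambda>_. UNIV" x] unfolding labels_def by blast
    then have "(\<Prod>q\<in>Q. pauli_gate PI (y q) (x q)) = 0"
      using assms by (intro prod_zero) auto
    then show ?thesis using True by (simp add: tensor_def)
  qed (auto simp: tensor_def)
qed

lemma omult_pauli_string_PI_left:
  assumes "finite P" "V \<in> opers P Q"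
  shows "omult P (pauli_string P (\<lambda>_. PI)) V = V"
proof (intro ext)
  fix y x
  have "omult P (pauli_string P (\<lambda>_. PI)) V y x
      = (\<Sum>z\<in>labels P. if z = y then V z x else 0)"
    by (auto simp: omult_def pauli_string_PI[OF assms(1)] intro!: sum.cong)
  then show "omult P (pauli_string P (\<lambda>_. PI)) V y x = V y x"
    using assms by (simp add: finite_labels opers_def)
qed

lemma omult_pauli_string_PI_right:
  assumes "finite Q" "V \<in> opers P Q"
  shows "omult Q V (pauli_string Q (\<lambda>_. PI)) = V"
proof (intro ext)
  fix y x
  have "omult Q V (pauli_string Q (\<lambda>_. PI)) y x
      = (\<Sum>z\<in>labels Q. if z = x then V y z else 0)"
    by (auto simp: omult_def pauli_string_PI[OF assms(1)] intro!: sum.cong)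
  then show "omult Q V (pauli_string Q (\<lambda>_. PI)) y x = V y x"
    using assms by (simp add: finite_labels opers_def)
qed

section \<open>Encoders\<close>

text \<open>The two strings pass through \<open>V\<close> one after the other, and the product of
  their images is a string up to a phase. The factor \<open>c\<close> in \<open>eq\<close> is there
  because \<open>r\<close> itself is a product of strings only up to a phase.\<close>

lemma maps_pauli_mult:
  assumes "finite P" and "maps_pauli P Q V p" and "maps_pauli P Q V p'" and "cmod c = 1"
    and eq: "pauli_string Q r = (\<lambda>y x. c * omult Q (pauli_string Q p) (pauli_string Q p') y x)"
  shows "maps_pauli P Q V r"
proof -
  obtain a s where a: "cmod a = 1"
    "omult Q V (pauli_string Q p) = (\<lambda>y x. a * omult P (pauli_string P s) V y x)"
    using assms(2) by (auto simp: maps_pauli_def)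
  obtain a' s' where a': "cmod a' = 1"
    "omult Q V (pauli_string Q p') = (\<lambda>y x. a' * omult P (pauli_string P s') V y x)"
    using assms(3) by (auto simp: maps_pauli_def)
  obtain e t where e: "cmod e = 1"
    "omult P (pauli_string P s) (pauli_string P s') = (\<lambda>y x. e * pauli_string P t y x)"
    using omult_pauli_string[OF assms(1)] by blast
  have "omult Q V (omult Q (pauli_string Q p) (pauli_string Q p'))
      = (\<lambda>y x. a * omult P (pauli_string P s) (omult Q V (pauli_string Q p')) y x)"
    by (simp add: omult_assoc[of Q V] a(2) omult_scale_left flip: omult_assoc[of P _ Q V])
  also have "\<dots> = (\<lambda>y x. a * a' * omult P (omult P (pauli_string P s) (pauli_string P s')) V y x)"
    by (simp add: a'(2) omult_scale_right omult_assoc mult.assoc)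
  also have "\<dots> = (\<lambda>y x. a * a' * e * omult P (pauli_string P t) V y x)"
    by (simp add: e(2) omult_scale_left mult.assoc)
  finally have "omult Q V (pauli_string Q r)
      = (\<lambda>y x. c * a * a' * e * omult P (pauli_string P t) V y x)"
    by (simp add: eq omult_scale_right mult.assoc)
  moreover have "cmod (c * a * a' * e) = 1"
    by (simp add: norm_mult a(1) a'(1) e(1) assms(4))
  ultimately show ?thesis
    unfolding maps_pauli_def by blast
qed

text \<open>An element of the Pauli group is a power of \<open>\<i>\<close> times a string, and the
  phase in \<open>maps_pauli\<close> absorbs that power.\<close>

lemma maps_pauli_of_carrier:
  assumes "A \<in> carrier (pauli_group P)"
    and "omult Q V (pauli_string Q p) = omult P A V"
  shows "maps_pauli P Q V p"
proof -
  obtain c r where "A = (\<lambda>y x. \<i> ^ c * pauli_string P r y x)"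
    using assms(1) by (auto simp: pauli_group_def pauli_oper_def)
  then have "omult Q V (pauli_string Q p) = (\<lambda>y x. \<i> ^ c * omult P (pauli_string P r) V y x)"
    by (simp add: assms(2) omult_scale_left)
  moreover have "cmod (\<i> ^ c) = 1"
    by (simp add: norm_power)
  ultimately show ?thesis
    unfolding maps_pauli_def by blast
qed

text \<open>The single-qubit X and Z gates generate all strings up to phase, and the strings that
  pass through \<open>V\<close> are closed under products.\<close>

lemma maps_pauli_all:
  assumes "finite P" "finite Q" "V \<in> opers P Q"
    and X: "\<And>q. q \<in> Q \<Longrightarrow> maps_pauli P Q V ((\<lambda>_. PI)(q := PX))"
    and Z: "\<And>q. q \<in> Q \<Longrightarrow> maps_pauli P Q V ((\<lambda>_. PI)(q := PZ))"
  shows "maps_pauli P Q V p"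
proof -
  have I: "maps_pauli P Q V (\<lambda>_. PI)"
    unfolding maps_pauli_def
    by (rule exI[of _ 1], rule exI[of _ "\<lambda>_. PI"])
      (simp add: omult_pauli_string_PI_left[OF assms(1,3)] omult_pauli_string_PI_right[OF assms(2,3)])
  have Y: "maps_pauli P Q V ((\<lambda>_. PI)(q := PY))" if q: "q \<in> Q" for q
  proof (rule maps_pauli_mult[OF assms(1) X[OF q] Z[OF q]])
    \<comment> \<open>Y = \<open>\<i>\<close> X Z at the qubit \<open>q\<close>, while at every
      other qubit the product of identities needs no factor.\<close>
    let ?c = "\<lambda>r. if r = q then \<i> else 1"
    have "pauli_string Q ((\<lambda>_. PI)(q := PY)) =
        tensor Q (\<lambda>r a b. ?c r * (\<Sum>z\<in>UNIV. pauli_gate (((\<lambda>_. PI)(q := PX)) r) a z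
          * pauli_gate (((\<lambda>_. PI)(q := PZ)) r) z b))"
      by (rule tensor_cong) (auto simp: UNIV_bool)
    also have "\<dots> = (\<lambda>y x. (\<Prod>r\<in>Q. ?c r) * omult Q (pauli_string Q ((\<lambda>_. PI)(q := PX)))
        (pauli_string Q ((\<lambda>_. PI)(q := PZ))) y x)"
      by (simp only: tensor_scale omult_tensor[OF assms(2)])
    also have "(\<Prod>r\<in>Q. ?c r) = \<i>"
      using q assms(2) by simp
    finally show "pauli_string Q ((\<lambda>_. PI)(q := PY)) = (\<lambda>y x. \<i> * omult Q
        (pauli_string Q ((\<lambda>_. PI)(q := PX))) (pauli_string Q ((\<lambda>_. PI)(q := PZ))) y x)" .
  qed simp
  have single: "maps_pauli P Q V ((\<lambda>_. PI)(q := s))" if "q \<in> Q" for q s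
    using I X Y Z that by (cases s) (auto simp: fun_upd_idem)
  \<comment> \<open>The string is built up qubit by qubit, by induction on the set \<open>F\<close>
    where it already agrees with \<open>p\<close>.\<close>
  have "maps_pauli P Q V (\<lambda>q. if q \<in> F then p q else PI)" if "finite F" "F \<subseteq> Q" for F
    using that
  proof (induction F rule: finite_induct)
    case empty
    then show ?case using I by simp
  next
    case (insert q F)
    \<comment> \<open>The old string is \<open>PI\<close> at the new qubit and the new factor is
      \<open>PI\<close> everywhere else, so the product is exact and the phase is 1.\<close>
    show ?case
    proof (rule maps_pauli_mult[OF assms(1) insert.IH single[of q "p q"], of 1])
      show "pauli_string Q (\<lambda>r. if r \<in> insert q F then p r else PI) =
        (\<lambda>y x. 1 * omult Q (pauli_string Q (\<lambda>r. if r \<in> F then p r else PI))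
          (pauli_string Q ((\<lambda>_. PI)(q := p q))) y x)"
        unfolding mult_1 omult_tensor[OF assms(2)]
        using insert.hyps(2) by (intro tensor_cong) (auto simp: UNIV_bool)
    qed (use insert.prems in auto)
  qed
  from this[OF assms(2)] have "maps_pauli P Q V (\<lambda>q. if q \<in> Q then p q else PI)" by simp
  \<comment> \<open>A tensor product over \<open>Q\<close> reads its gates only at qubits of
    \<open>Q\<close>.\<close>
  moreover have "pauli_string Q (\<lambda>q. if q \<in> Q then p q else PI) = pauli_string Q p"
    by (rule tensor_cong) simp
  ultimately show ?thesis
    by (simp add: maps_pauli_def)
qed

text \<open>The encoder turns X and Z on the \<open>j\<close>-th logical qubit into
  \<open>X j\<close> and \<open>Z j\<close>. These lie in the centralizer of the stabilizer, hence
  in the Pauli group.\<close>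

lemma maps_pauli_encoder:
  assumes "symplectic_basis n k S X Z" and enc: "encoder n k S X Z V"
  shows "maps_pauli {..<n} {..<k} V p"
proof (rule maps_pauli_all)
  have at: "pauli_at Q s q = pauli_string Q ((\<lambda>_. PI)(q := s))" for Q s and q :: nat
    by (simp add: pauli_at_def pauli_oper_def)
  fix j assume j: "j \<in> {..<k}"
  have "X j \<in> carrier (pauli_group {..<n})" "Z j \<in> carrier (pauli_group {..<n})"
    using assms(1) j by (auto simp: symplectic_basis_def pauli_centralizer_def)
  moreover have "omult {..<k} V (pauli_at {..<k} PX j) = omult {..<n} (X j) V"
    "omult {..<k} V (pauli_at {..<k} PZ j) = omult {..<n} (Z j) V"
    using enc j by (auto simp: encoder_def)
  ultimately show "maps_pauli {..<n} {..<k} V ((\<lambda>_. PI)(j := PX))"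
    "maps_pauli {..<n} {..<k} V ((\<lambda>_. PI)(j := PZ))"
    unfolding at by (blast intro: maps_pauli_of_carrier)+
qed (use enc in \<open>auto simp: encoder_def\<close>)

section \<open>Tensor products over blocks\<close>

text \<open>Currying: once qubits are pairs of a block and a position, a label of all qubits is the
  same as a family of labels, one per block. Sums over labels thereby become sums over families, to
  which distributivity applies.\<close>

lemma bij_betw_labels_blocks:
  assumes "bij_betw (\<lambda>(b, j). \<phi> b j) (R \<times> J) Q"
  shows "bij_betw (\<lambda>z. \<lambda>b\<in>R. \<lambda>j\<in>J. z (\<phi> b j)) (labels Q) (R \<rightarrow>\<^sub>E labels J)"
\<comment> \<open>The inverse finds the block and position of a qubit by \<open>inv_into\<close> and
  reads the bit there. The restrictions fix the default value outside the index sets, so both round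
  trips are equalities of functions.\<close>
proof (rule bij_betw_byWitness[where f' = "\<lambda>w. \<lambda>q\<in>Q. case inv_into (R \<times> J) (\<lambda>(b, j). \<phi> b j) q of (b, j) \<Rightarrow> w b j"])
  let ?\<phi> = "\<lambda>(b, j). \<phi> b j"
  have inv: "inv_into (R \<times> J) ?\<phi> (\<phi> b j) = (b, j)" if "b \<in> R" "j \<in> J" for b j
    using inv_into_f_f[of ?\<phi> "R \<times> J" "(b, j)"] assms that by (auto simp: bij_betw_def)
  have \<phi>: "\<phi> b j \<in> Q" if "b \<in> R" "j \<in> J" for b j
    using assms that by (auto simp: bij_betw_def)
  have ex: "\<exists>b\<in>R. \<exists>j\<in>J. q = \<phi> b j" if "q \<in> Q" for q
    using assms that by (auto simp: bij_betw_def)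
  show "\<forall>z\<in>labels Q. (\<lambda>q\<in>Q. case inv_into (R \<times> J) ?\<phi> q of
      (b, j) \<Rightarrow> (\<lambda>b\<in>R. \<lambda>j\<in>J. z (\<phi> b j)) b j) = z"
  proof
    fix z assume z: "z \<in> labels Q"
    show "(\<lambda>q\<in>Q. case inv_into (R \<times> J) ?\<phi> q of
      (b, j) \<Rightarrow> (\<lambda>b\<in>R. \<lambda>j\<in>J. z (\<phi> b j)) b j) = z"
    proof
      fix q
      show "(\<lambda>q\<in>Q. case inv_into (R \<times> J) ?\<phi> q of
        (b, j) \<Rightarrow> (\<lambda>b\<in>R. \<lambda>j\<in>J. z (\<phi> b j)) b j) q = z q"
        using z ex[of q] by (cases "q \<in> Q") (auto simp: inv labels_def PiE_def extensional_def)
    qed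
  qed
  show "\<forall>w\<in>R \<rightarrow>\<^sub>E labels J. (\<lambda>b\<in>R. \<lambda>j\<in>J. (\<lambda>q\<in>Q. case inv_into (R \<times> J) ?\<phi> q of
      (b, j) \<Rightarrow> w b j) (\<phi> b j)) = w"
  proof
    fix w assume w: "w \<in> R \<rightarrow>\<^sub>E labels J"
    show "(\<lambda>b\<in>R. \<lambda>j\<in>J. (\<lambda>q\<in>Q. case inv_into (R \<times> J) ?\<phi> q of (b, j) \<Rightarrow> w b j) (\<phi> b j)) = w"
    proof (intro ext)
      fix b j
      show "(\<lambda>b\<in>R. \<lambda>j\<in>J. (\<lambda>q\<in>Q. case inv_into (R \<times> J) ?\<phi> q of (b, j) \<Rightarrow> w b j) (\<phi> b j)) b j = w b j"
      proof (cases "b \<in> R")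
        case True
        then have "w b \<in> labels J" using w by auto
        then show ?thesis
          using True by (cases "j \<in> J") (auto simp: inv \<phi> labels_def PiE_def extensional_def)
      qed (use w in \<open>auto simp: PiE_def extensional_def\<close>)
    qed
  qed
qed (auto simp: labels_def)

text \<open>The tensor product of the operators \<open>F b\<close> over the blocks, where
  \<open>\<theta> b\<close> and \<open>\<phi> b\<close> place the output and input qubits of block
  \<open>b\<close>. Level encoders and product gates regrouped by blocks both have this form, so one
  multiplication rule serves for both.\<close>

definition block_oper :: "'b set \<Rightarrow> 'p set \<Rightarrow> 'q set \<Rightarrow> 'i set \<Rightarrow> 'j set \<Rightarrow>
    ('b \<Rightarrow> 'i \<Rightarrow> 'p) \<Rightarrow> ('b \<Rightarrow> 'j \<Rightarrow> 'q) \<Rightarrow> ('b \<Rightarrow> ('i, 'j) oper) \<Rightarrow> ('p, 'q) oper" where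
  "block_oper R P Q I J \<theta> \<phi> F = (\<lambda>y x. if y \<in> labels P \<and> x \<in> labels Q
     then \<Prod>b\<in>R. F b (\<lambda>i\<in>I. y (\<theta> b i)) (\<lambda>j\<in>J. x (\<phi> b j)) else 0)"

text \<open>The sum over labels of the middle qubits \<open>Q\<close> splits into independent sums,
  one for each block.\<close>

lemma omult_block_oper:
  fixes P :: "'p set" and Q' :: "'r set"
  assumes bij: "bij_betw (\<lambda>(b, j). \<phi> b j) (R \<times> J) Q" and "finite R" "finite J"
  shows "omult Q (block_oper R P Q I J \<theta> \<phi> F) (block_oper R Q Q' J J' \<phi> \<chi> F') =
    block_oper R P Q' I J' \<theta> \<chi> (\<lambda>b. omult J (F b) (F' b))"
proof (intro ext)
  fix y :: "'p \<Rightarrow> bool" and x :: "'r \<Rightarrow> bool"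
  let ?y = "\<lambda>b. \<lambda>i\<in>I. y (\<theta> b i)" and ?x = "\<lambda>b. \<lambda>j\<in>J'. x (\<chi> b j)"
  let ?f = "\<lambda>b w. F b (?y b) w * F' b w (?x b)"
  show "omult Q (block_oper R P Q I J \<theta> \<phi> F) (block_oper R Q Q' J J' \<phi> \<chi> F') y x =
    block_oper R P Q' I J' \<theta> \<chi> (\<lambda>b. omult J (F b) (F' b)) y x"
  proof (cases "y \<in> labels P \<and> x \<in> labels Q'")
    case True
    \<comment> \<open>The summand is written as a function of the curried label, outer restriction
      to \<open>R\<close> included, so that the sum can be reindexed.\<close>
    have "omult Q (block_oper R P Q I J \<theta> \<phi> F) (block_oper R Q Q' J J' \<phi> \<chi> F') y x
        = (\<Sum>z\<in>labels Q. \<Prod>b\<in>R. ?f b ((\<lambda>b\<in>R. \<lambda>j\<in>J. z (\<phi> b j)) b))"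
      using True by (simp add: omult_def block_oper_def prod.distrib)
    also have "\<dots> = (\<Sum>w\<in>R \<rightarrow>\<^sub>E labels J. \<Prod>b\<in>R. ?f b (w b))"
      by (rule sum.reindex_bij_betw[OF bij_betw_labels_blocks[OF bij]])
    also have "\<dots> = (\<Prod>b\<in>R. \<Sum>w\<in>labels J. ?f b w)"
      using assms by (simp add: prod_sum_PiE finite_labels)
    also have "\<dots> = block_oper R P Q' I J' \<theta> \<chi> (\<lambda>b. omult J (F b) (F' b)) y x"
      using True by (simp add: omult_def block_oper_def)
    finally show ?thesis .
  qed (auto simp: omult_def block_oper_def)
qed

lemma tensor_block_oper:
  assumes bij: "bij_betw (\<lambda>(b, j). \<phi> b j) (R \<times> J) Q"
  shows "tensor Q G = block_oper R Q Q J J \<phi> \<phi> (\<lambda>b. tensor J (\<lambda>j. G (\<phi> b j)))"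
proof (intro ext)
  fix y x
  have "(\<Prod>q\<in>Q. G q (y q) (x q)) = (\<Prod>(b, j)\<in>R \<times> J. G (\<phi> b j) (y (\<phi> b j)) (x (\<phi> b j)))"
    using prod.reindex_bij_betw[OF bij, of "\<lambda>q. G q (y q) (x q)"]
    by (simp add: case_prod_unfold)
  then show "tensor Q G y x = block_oper R Q Q J J \<phi> \<phi> (\<lambda>b. tensor J (\<lambda>j. G (\<phi> b j))) y x"
    by (simp add: tensor_def block_oper_def labels_def prod.cartesian_product)
qed

text \<open>Each block passes its own share of the string through its copy of \<open>V\<close>. The
  phases multiply and the images are glued together.\<close>

lemma maps_pauli_block_oper:
  assumes bij\<theta>: "bij_betw (\<lambda>(b, i). \<theta> b i) (R \<times> I) P"
    and bij\<phi>: "bij_betw (\<lambda>(b, j). \<phi> b j) (R \<times> J) Q"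
    and fin: "finite R" "finite I" "finite J"
    and V: "\<And>p. maps_pauli I J V p"
  shows "maps_pauli P Q (block_oper R P Q I J \<theta> \<phi> (\<lambda>_. V)) p"
proof -
  obtain c s where c: "\<And>b. cmod (c b) = 1"
    and s: "\<And>b. omult J V (pauli_string J (\<lambda>j. p (\<phi> b j)))
      = (\<lambda>y x. c b * omult I (pauli_string I (s b)) V y x)"
    using V[of "\<lambda>j. p (\<phi> b j)" for b] unfolding maps_pauli_def by metis
  \<comment> \<open>The glued string: \<open>inv_into\<close> recovers the block and position of a
    qubit, and the image string of that block is read there.\<close>
  define p' where "p' = (\<lambda>q. case inv_into (R \<times> I) (\<lambda>(b, i). \<theta> b i) q of (b, i) \<Rightarrow> s b i)"
  have p': "p' (\<theta> b i) = s b i" if "b \<in> R" "i \<in> I" for b i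
    using inv_into_f_f[of "\<lambda>(b, i). \<theta> b i" "R \<times> I" "(b, i)"] bij\<theta> that
    by (simp add: bij_betw_def p'_def)
  have eq: "tensor I (\<lambda>i. pauli_gate (p' (\<theta> b i))) = pauli_string I (s b)" if "b \<in> R" for b
    using that by (intro tensor_cong) (simp add: p')
  have "omult Q (block_oper R P Q I J \<theta> \<phi> (\<lambda>_. V)) (pauli_string Q p)
      = block_oper R P Q I J \<theta> \<phi> (\<lambda>b. omult J V (pauli_string J (\<lambda>j. p (\<phi> b j))))"
    by (simp add: tensor_block_oper[OF bij\<phi>] omult_block_oper[OF bij\<phi> fin(1,3)])
  also have "\<dots> = (\<lambda>y x. (\<Prod>b\<in>R. c b) *
      block_oper R P Q I J \<theta> \<phi> (\<lambda>b. omult I (pauli_string I (s b)) V) y x)"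
    by (auto simp: s block_oper_def prod.distrib fun_eq_iff)
  also have "block_oper R P Q I J \<theta> \<phi> (\<lambda>b. omult I (pauli_string I (s b)) V)
      = block_oper R P Q I J \<theta> \<phi> (\<lambda>b. omult I (tensor I (\<lambda>i. pauli_gate (p' (\<theta> b i)))) V)"
    by (auto simp: block_oper_def eq fun_eq_iff)
  also have "\<dots> = omult P (pauli_string P p') (block_oper R P Q I J \<theta> \<phi> (\<lambda>_. V))"
    by (simp add: tensor_block_oper[OF bij\<theta>] omult_block_oper[OF bij\<theta> fin(1,2)])
  finally have "omult Q (block_oper R P Q I J \<theta> \<phi> (\<lambda>_. V)) (pauli_string Q p)
      = (\<lambda>y x. (\<Prod>b\<in>R. c b) * omult P (pauli_string P p') (block_oper R P Q I J \<theta> \<phi> (\<lambda>_. V)) y x)" .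
  moreover have "cmod (\<Prod>b\<in>R. c b) = 1"
    by (simp add: c flip: prod_norm)
  ultimately show ?thesis
    unfolding maps_pauli_def by blast
qed

section \<open>Concatenation\<close>

text \<open>Taking coordinate \<open>l\<close> out of an index and putting it back are mutually
  inverse. This identifies a qubit with its block and its position in it.\<close>

lemma bij_betw_PiE_fun_upd:
  assumes "l \<in> A"
  shows "bij_betw (\<lambda>(b, j). b(l := j)) ((\<Pi>\<^sub>E p\<in>A - {l}. B p) \<times> B l) (\<Pi>\<^sub>E p\<in>A. B p)"
proof (rule bij_betw_byWitness[where f' = "\<lambda>q. (restrict q (A - {l}), q l)"])
  show "\<forall>x\<in>(\<Pi>\<^sub>E p\<in>A - {l}. B p) \<times> B l. (restrict (case x of (b, j) \<Rightarrow> b(l := j)) (A - {l}),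
      (case x of (b, j) \<Rightarrow> b(l := j)) l) = x"
    by (fastforce simp: PiE_def extensional_def)
  show "\<forall>q\<in>Pi\<^sub>E A B. (case (restrict q (A - {l}), q l) of (b, j) \<Rightarrow> b(l := j)) = q"
    using assms by (fastforce simp: PiE_def extensional_def)
  show "(\<lambda>(b, j). b(l := j)) ` ((\<Pi>\<^sub>E p\<in>A - {l}. B p) \<times> B l) \<subseteq> Pi\<^sub>E A B"
    using assms by (fastforce simp: PiE_def extensional_def Pi_def)
  show "(\<lambda>q. (restrict q (A - {l}), q l)) ` Pi\<^sub>E A B \<subseteq> (\<Pi>\<^sub>E p\<in>A - {l}. B p) \<times> B l"
    using assms by (auto simp: PiE_def Pi_def)
qed

lemma maps_pauli_level_encoder:
  assumes l: "l \<in> {1..L}" and V: "\<And>p. maps_pauli {..<n l} {..<k l} (V l) p"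
  shows "maps_pauli (level_qubits n k L (l - 1)) (level_qubits n k L l) (level_encoder n k L V l) p"
proof -
  have fin: "finite (blocks n k L l)"
    unfolding blocks_def by (intro finite_PiE) auto
  \<comment> \<open>With coordinate \<open>l\<close> removed, and as \<open>l\<close> is positive,
    the conditions \<open>p < l\<close>, \<open>p \<le> l - 1\<close> and \<open>p \<le> l\<close>
    coincide. So the same blocks index both levels; only the range of coordinate \<open>l\<close>
    changes, from \<open>n l\<close> to \<open>k l\<close>.\<close>
  have lower: "blocks n k L l = (\<Pi>\<^sub>E p\<in>{1..L} - {l}. {..<(if p \<le> l - 1 then k p else n p)})"
    unfolding blocks_def using l by (intro PiE_cong) auto
  have upper: "blocks n k L l = (\<Pi>\<^sub>E p\<in>{1..L} - {l}. {..<(if p \<le> l then k p else n p)})"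
    unfolding blocks_def by (intro PiE_cong) auto
  have "bij_betw (\<lambda>(b, i). b(l := i)) (blocks n k L l \<times> {..<n l}) (level_qubits n k L (l - 1))"
    using bij_betw_PiE_fun_upd[OF l, of "\<lambda>p. {..<(if p \<le> l - 1 then k p else n p)}"] l
    by (simp add: lower level_qubits_def split: if_splits)
  moreover have "bij_betw (\<lambda>(b, j). b(l := j)) (blocks n k L l \<times> {..<k l}) (level_qubits n k L l)"
    using bij_betw_PiE_fun_upd[OF l, of "\<lambda>p. {..<(if p \<le> l then k p else n p)}"]
    by (simp add: upper level_qubits_def)
  moreover have "level_encoder n k L V l = block_oper (blocks n k L l) (level_qubits n k L (l - 1))
      (level_qubits n k L l) {..<n l} {..<k l} (\<lambda>b i. b(l := i)) (\<lambda>b j. b(l := j)) (\<lambda>_. V l)"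
    by (simp add: level_encoder_def block_oper_def)
  ultimately show ?thesis
    using maps_pauli_block_oper[OF _ _ fin finite_lessThan finite_lessThan V] by simp
qed

lemma encode_scale: "encode n k L V m l (\<lambda>x. c * \<psi> x) = (\<lambda>y. c * encode n k L V m l \<psi> y)"
  by (induction l arbitrary: \<psi>) (simp_all add: oapply_scale_right)

text \<open>\<open>encode\<close> applies the encoder of the top level first, so the string is
  replaced by its image one level down and the induction hypothesis takes over; hence
  \<open>p\<close> must be arbitrary. Phase and image string are chosen before the state, as
  \<open>same_action\<close> demands.\<close>

lemma encode_pauli_string:
  assumes V: "\<And>i p. i \<in> {1..L} \<Longrightarrow> maps_pauli {..<n i} {..<k i} (V i) p"
    and "m \<le> l" "l \<le> L"
  shows "\<exists>c p'. cmod c = 1 \<and> (\<forall>\<psi>.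
    encode n k L V m l (oapply (level_qubits n k L l) (pauli_string (level_qubits n k L l) p) \<psi>) =
    (\<lambda>y. c * oapply (level_qubits n k L m) (pauli_string (level_qubits n k L m) p')
      (encode n k L V m l \<psi>) y))"
  using assms(2,3)
proof (induction l arbitrary: p)
  case 0
  then show ?case
    by (intro exI[of _ 1] exI[of _ p]) simp
next
  case (Suc l)
  let ?Q = "level_qubits n k L" and ?E = "level_encoder n k L V (Suc l)"
  show ?case
  proof (cases "m = Suc l")
    case True
    \<comment> \<open>No level is crossed: \<open>encode\<close> is the identity here and the string
      is its own image.\<close>
    then show ?thesis by (intro exI[of _ 1] exI[of _ p]) simp
  next
    case False
    then have m: "m \<le> l" using Suc.prems by simp
    have "maps_pauli (?Q l) (?Q (Suc l)) ?E p"
      using maps_pauli_level_encoder[of "Suc l" L n k V p] V Suc.prems by simp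
    then obtain c s where c: "cmod c = 1"
      and s: "omult (?Q (Suc l)) ?E (pauli_string (?Q (Suc l)) p)
        = (\<lambda>y x. c * omult (?Q l) (pauli_string (?Q l) s) ?E y x)"
      unfolding maps_pauli_def by blast
    obtain e r where e: "cmod e = 1"
      and r: "\<And>\<psi>. encode n k L V m l (oapply (?Q l) (pauli_string (?Q l) s) \<psi>) =
        (\<lambda>y. e * oapply (?Q m) (pauli_string (?Q m) r) (encode n k L V m l \<psi>) y)"
      using Suc.IH[OF m, of s] Suc.prems by auto
    have "oapply (?Q (Suc l)) ?E (oapply (?Q (Suc l)) (pauli_string (?Q (Suc l)) p) \<psi>) =
        (\<lambda>y. c * oapply (?Q l) (pauli_string (?Q l) s) (oapply (?Q (Suc l)) ?E \<psi>) y)" for \<psi>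
      by (simp add: oapply_omult s oapply_scale_left)
    then have "encode n k L V m (Suc l) (oapply (?Q (Suc l)) (pauli_string (?Q (Suc l)) p) \<psi>) =
        (\<lambda>y. c * e * oapply (?Q m) (pauli_string (?Q m) r) (encode n k L V m (Suc l) \<psi>) y)" for \<psi>
      using m by (simp add: encode_scale r mult.assoc)
    moreover have "cmod (c * e) = 1"
      by (simp add: norm_mult c e)
    ultimately show ?thesis by blast
  qed
qed

theorem theorem2:
  fixes L N K d\<^sub>c\<^sub>o\<^sub>n l :: nat
    and n k d :: "nat \<Rightarrow> nat"
    and D :: "nat \<Rightarrow> bit vec set"
    and G :: "nat \<Rightarrow> bit mat"
    and h :: "nat \<Rightarrow> nat \<Rightarrow> bit vec"
    and X Z :: "nat \<Rightarrow> nat \<Rightarrow> (nat, nat) oper"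
    and V :: "nat \<Rightarrow> (nat, nat) oper"
    and B A :: "nat \<Rightarrow> nat set"
    and U :: "(qubit, qubit) oper"
  assumes "L \<ge> 1"
    and "\<And>i. i \<in> {1..L} \<Longrightarrow> self_dual_css_code (D i) (G i) (n i) (k i) (d i)"
    and "\<And>i. i \<in> {1..L} \<Longrightarrow> k i \<ge> 1"
    and "\<And>i. i \<in> {1..L} \<Longrightarrow> dual_code (n i) (D i) \<subset> D i"
    and "\<And>i. i \<in> {1..L} \<Longrightarrow> h i ` {..<k i} \<subseteq> carrier_vec (n i)"
    and "\<And>i. i \<in> {1..L} \<Longrightarrow>
           D i = code_span (n i) (dual_code (n i) (D i) \<union> h i ` {..<k i})"
    and "\<And>i. i \<in> {1..L} \<Longrightarrow> \<exists>j<k i. h i j \<bullet> h i j = 1"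
    and "\<And>i. i \<in> {1..L} \<Longrightarrow>
           compatible_symplectic_basis (n i) (k i) (css_stabilizer (n i) (G i)) (X i) (Z i) (V i)"
    and "concatenated_code_params n k L V N K d\<^sub>c\<^sub>o\<^sub>n"
    and "l \<le> L"
    and "\<And>i. i \<in> {1..l} \<Longrightarrow> B i \<subseteq> {..<k i}"
    and "\<And>i. i \<in> {l + 1..L} \<Longrightarrow> A i \<subseteq> {..<n i}"
    and "pauli_type_gate n k L l B A U"
  shows "\<forall>m \<in> {0..l}. transversal_at n k L V l U m"
proof
  fix m assume "m \<in> {0..l}"
  then have m: "m \<le> l" by simp
  \<comment> \<open>Qubits outside the product index set carry \<open>PI\<close>, so the gate is a
    Pauli string on all level-\<open>l\<close> qubits.\<close>
  obtain p where U: "U = pauli_string (level_qubits n k L l) p"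
    using assms(13) by (auto simp: pauli_type_gate_def)
  have V: "maps_pauli {..<n i} {..<k i} (V i) p" if "i \<in> {1..L}" for i p
    using assms(8)[OF that] by (auto simp: compatible_symplectic_basis_def intro: maps_pauli_encoder)
  obtain c p' where "cmod c = 1" "\<And>\<psi>. encode n k L V m l (oapply (level_qubits n k L l) U \<psi>) =
      (\<lambda>y. c * oapply (level_qubits n k L m) (pauli_string (level_qubits n k L m) p')
        (encode n k L V m l \<psi>) y)"
    using encode_pauli_string[of L n k V, OF V m assms(10), of p] unfolding U by metis
  \<comment> \<open>The gates at level \<open>m\<close> are the Pauli gates of the image string,
    which are unitary; \<open>c\<close> is the global phase.\<close>
  then show "transversal_at n k L V l U m"
    unfolding transversal_at_def same_action_def
    by (intro exI[of _ "\<lambda>q. pauli_gate (p' q)"]) (auto simp: unitary1_pauli_gate)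
qed

end
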